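(* Let $G$ be a connected graph of order $n\ge 2$ with $V(G)=\{u_1,\ldots,u_n\}$ and let $\mathcal{H}=\{H_1,\ldots,H_n\}$ be a family of $n$ non-trivial graphs. The graph $G\circ\mathcal{H}$ is $k$-metric dimensional if and only if $k=\min\{\mathcal{T}(G\circ\mathcal{H}),\mathcal{C}(\mathcal{H})\}$.
   Context: All graphs are finite and simple; a graph is non-trivial if it has at least two vertices. $N_H(x)$ is the open and $N_H[x]=N_H(x)\cup\{x\}$ the closed neighborhood; $\delta(H)$ and $\Delta(H)$ are the minimum and maximum degree; $d_G$ is the shortest-path distance. The lexicographic product $G\circ\mathcal{H}$ has vertex set $\bigcup_{i=1}^n\{u_i\}\times V(H_i)$, and $(u_i,v)$ is adjacent to $(u_j,w)$ iff $u_iu_j\in E(G)$, or $i=j$ and $vw\in E(H_i)$. For a connected graph $X$ and positive integer $k$, a set $S\subseteq V(X)$ is a $k$-metric generator if every two distinct vertices $x,y$ admit at least $k$ vertices $w\in S$ with $d_X(x,w)\neq d_X(y,w)$; $X$ is $k$-metric dimensional if $k$ is the largest integer for which a $k$-metric generator of $X$ exists. For a graph $H$ and distinct $x,y\in V(H)$, $\mathcal{C}_H(x,y)=(N_H(x)\triangledown N_H(y))\cup\{x,y\}$ ($\triangledown$ = symmetric difference), $\mathcal{C}(H)=\min_{x\neq y}|\mathcal{C}_H(x,y)|$, and $\mathcal{C}(\mathcal{H})=\min_i\mathcal{C}(H_i)$. Distinct vertices $x,y$ of $G$ are true twins if $N_G[x]=N_G[y]$ and false twins if $N_G(x)=N_G(y)$.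 The relation $x\mathcal{R}y\iff N_G(x)-\{y\}=N_G(y)-\{x\}$ is an equivalence relation whose classes are singletons, false twin classes (any two members are false twins) or true twin classes (any two members are true twins). $S(G)$, $FT(G)$, $TT(G)$ denote the unions of the singleton, false twin and true twin classes; for $u_i\in FT(G)$ (resp. $TT(G)$) $FT(u_i)$ (resp. $TT(u_i)$) denotes its class. Define $\mathcal{T}(u_i,\mathcal{H})=|V(H_i)|$ if $u_i\in S(G)$; $\mathcal{T}(u_i,\mathcal{H})=\min\{\delta(H_j)+\delta(H_l)+2: u_j,u_l\in FT(u_i), j\neq l\}$ if $u_i\in FT(G)$; $\mathcal{T}(u_i,\mathcal{H})=\min\{|V(H_j)|-\Delta(H_j)+|V(H_l)|-\Delta(H_l): u_j,u_l\in TT(u_i), j\neq l\}$ if $u_i\in TT(G)$; and $\mathcal{T}(G\circ\mathcal{H})=\min_{u_i\in V(G)}\mathcal{T}(u_i,\mathcal{H})$. *)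

theory Defs
  imports "Graph_Theory.Graph_Theory"
begin

text \<open>
  Finite simple graphs are pairs of a vertex set and a symmetric irreflexive arc relation
  (locale \<^locale>\<open>pair_graph\<close>). Thus the out-neighbours of a vertex are its
  neighbours, and its out-degree is its degree.
\<close>

definition nbhd :: "'a pair_pre_digraph \<Rightarrow> 'a \<Rightarrow> 'a set" where
  "nbhd G x = parcs G `` {x}"

definition closed_nbhd :: "'a pair_pre_digraph \<Rightarrow> 'a \<Rightarrow> 'a set" where
  "closed_nbhd G x = insert x (nbhd G x)"

definition min_degree :: "'a pair_pre_digraph \<Rightarrow> nat" where
  "min_degree G = Min (out_degree (with_proj G) ` pverts G)"

definition max_degree :: "'a pair_pre_digraph \<Rightarrow> nat" where
  "max_degree G = Max (out_degree (with_proj G) ` pverts G)"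

definition graph_dist :: "'a pair_pre_digraph \<Rightarrow> 'a \<Rightarrow> 'a \<Rightarrow> ereal" where
  "graph_dist G = wf_digraph.\<mu> (with_proj G) (\<lambda>_. 1)"


subsection \<open>Lexicographic product\<close>

text \<open>The family is indexed by the vertices of the first factor.\<close>

definition lexicographic_product ::
    "'a pair_pre_digraph \<Rightarrow> ('a \<Rightarrow> 'b pair_pre_digraph) \<Rightarrow> ('a \<times> 'b) pair_pre_digraph" where
  "lexicographic_product G H =
    \<lparr> pverts = (SIGMA u : pverts G. pverts (H u)),
      parcs = {((u, v), (u', w)) | u v u' w.
        u \<in> pverts G \<and> u' \<in> pverts G \<and> v \<in> pverts (H u) \<and> w \<in> pverts (H u') \<and>
        ((u, u') \<in> parcs G \<or> u = u' \<and> (v, w) \<in> parcs (H u))} \<rparr>"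


subsection \<open>Metric generators\<close>

definition k_metric_generator :: "'a pair_pre_digraph \<Rightarrow> nat \<Rightarrow> 'a set \<Rightarrow> bool" where
  "k_metric_generator X k S \<longleftrightarrow> 0 < k \<and> S \<subseteq> pverts X \<and>
    (\<forall>x \<in> pverts X. \<forall>y \<in> pverts X. x \<noteq> y \<longrightarrow>
      k \<le> card {w \<in> S. graph_dist X x w \<noteq> graph_dist X y w})"

definition k_metric_dimensional :: "'a pair_pre_digraph \<Rightarrow> nat \<Rightarrow> bool" where
  "k_metric_dimensional X k \<longleftrightarrow>
    (\<exists>S. k_metric_generator X k S) \<and> (\<forall>k' S. k_metric_generator X k' S \<longrightarrow> k' \<le> k)"


subsection \<open>The quantity \<open>\<C>\<close>\<close>

definition C_set :: "'a pair_pre_digraph \<Rightarrow> 'a \<Rightarrow> 'a \<Rightarrow> 'a set" where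
  "C_set H x y = ((nbhd H x - nbhd H y) \<union> (nbhd H y - nbhd H x)) \<union> {x, y}"

definition C_graph :: "'a pair_pre_digraph \<Rightarrow> nat" where
  "C_graph H = Min {card (C_set H x y) | x y. x \<in> pverts H \<and> y \<in> pverts H \<and> x \<noteq> y}"

definition C_family :: "'a pair_pre_digraph \<Rightarrow> ('a \<Rightarrow> 'b pair_pre_digraph) \<Rightarrow> nat" where
  "C_family G H = Min ((\<lambda>u. C_graph (H u)) ` pverts G)"


subsection \<open>Twin classes\<close>

definition true_twins :: "'a pair_pre_digraph \<Rightarrow> 'a \<Rightarrow> 'a \<Rightarrow> bool" where
  "true_twins G x y \<longleftrightarrow> x \<noteq> y \<and> closed_nbhd G x = closed_nbhd G y"

definition false_twins :: "'a pair_pre_digraph \<Rightarrow> 'a \<Rightarrow> 'a \<Rightarrow> bool" where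
  "false_twins G x y \<longleftrightarrow> x \<noteq> y \<and> nbhd G x = nbhd G y"

definition twin_rel :: "'a pair_pre_digraph \<Rightarrow> 'a rel" where
  "twin_rel G = {(x, y). x \<in> pverts G \<and> y \<in> pverts G \<and> nbhd G x - {y} = nbhd G y - {x}}"

definition singleton_verts :: "'a pair_pre_digraph \<Rightarrow> 'a set" where
  "singleton_verts G = \<Union> {c \<in> pverts G // twin_rel G. is_singleton c}"

definition false_twin_verts :: "'a pair_pre_digraph \<Rightarrow> 'a set" where
  "false_twin_verts G = \<Union> {c \<in> pverts G // twin_rel G.
    \<not> is_singleton c \<and> (\<forall>x \<in> c. \<forall>y \<in> c. x \<noteq> y \<longrightarrow> false_twins G x y)}"

definition true_twin_verts :: "'a pair_pre_digraph \<Rightarrow> 'a set" where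
  "true_twin_verts G = \<Union> {c \<in> pverts G // twin_rel G.
    \<not> is_singleton c \<and> (\<forall>x \<in> c. \<forall>y \<in> c. x \<noteq> y \<longrightarrow> true_twins G x y)}"

definition twin_class :: "'a pair_pre_digraph \<Rightarrow> 'a \<Rightarrow> 'a set" where
  "twin_class G u = twin_rel G `` {u}"


subsection \<open>The quantity \<open>\<T>\<close>\<close>

text \<open>
  The three vertex sets partition the vertices of a simple graph, so the last branch is never
  reached for a vertex. Since \<^prop>\<open>max_degree H < card (pverts H)\<close> for a
  simple graph with at least one vertex, the subtractions do not truncate.
\<close>

definition T_vert :: "'a pair_pre_digraph \<Rightarrow> ('a \<Rightarrow> 'b pair_pre_digraph) \<Rightarrow> 'a \<Rightarrow> nat" where
  "T_vert G H u =
    (if u \<in> singleton_verts G then card (pverts (H u))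
     else if u \<in> false_twin_verts G then
       Min {min_degree (H j) + min_degree (H l) + 2 | j l.
              j \<in> twin_class G u \<and> l \<in> twin_class G u \<and> j \<noteq> l}
     else if u \<in> true_twin_verts G then
       Min {(card (pverts (H j)) - max_degree (H j)) + (card (pverts (H l)) - max_degree (H l)) | j l.
              j \<in> twin_class G u \<and> l \<in> twin_class G u \<and> j \<noteq> l}
     else undefined)"

definition T_family :: "'a pair_pre_digraph \<Rightarrow> ('a \<Rightarrow> 'b pair_pre_digraph) \<Rightarrow> nat" where
  "T_family G H = Min (T_vert G H ` pverts G)"

end

theory Submission
  imports Defs
begin

text \<open>
  The whole vertex set is the best metric generator, so the dimension is the least number of
  vertices that distinguish a pair. In the product a pair in the fibre over \<open>u\<close> is
  distinguished exactly by its set \<open>\<C>\<close>; a pair over twins \<open>u\<close>, \<open>u'\<close> only by vertices over \<open>u\<close> and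
  \<open>u'\<close>, namely by closed neighbourhoods (false twins) or complements of neighbourhoods (true twins),
  which gives the quantity \<open>\<T>\<close>; and a pair over non-twins by the whole fibre over some third vertex,
  whose size is at least \<open>\<C>\<close>.
\<close>

section \<open>Distances\<close>

lemma in_nbhd_iff: "y \<in> nbhd G x \<longleftrightarrow> (x, y) \<in> parcs G"
  by (simp add: nbhd_def)

context pair_wf_digraph
begin

text \<open>Relation powers stand in for walks from here on: projecting, lifting and rerouting a
  walk become inductions on a length, without lists of arcs.\<close>

lemma relpow_iff_awalk:
  assumes "u \<in> pverts G"
  shows "(u, v) \<in> parcs G ^^ n \<longleftrightarrow> (\<exists>p. awalk u p v \<and> length p = n)"
  using assms
proof (induction n arbitrary: u)
  case 0
  then show ?case by (auto simp: awalk_Nil_iff)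
next
  case (Suc n)
  show ?case
  proof
    assume "(u, v) \<in> parcs G ^^ Suc n"
    then obtain w where w: "(u, w) \<in> parcs G" "(w, v) \<in> parcs G ^^ n"
      using relpow_Suc_D2 by metis
    then obtain p where "awalk w p v" "length p = n"
      using Suc.IH in_arcsD2 by blast
    then show "\<exists>p. awalk u p v \<and> length p = Suc n"
      using w Suc.prems by (intro exI[of _ "(u, w) # p"]) (auto simp: awalk_Cons_iff)
  next
    assume "\<exists>p. awalk u p v \<and> length p = Suc n"
    then obtain e p where "awalk u (e # p) v" "length p = n"
      by (auto simp: length_Suc_conv)
    then have e: "e \<in> parcs G" "fst e = u" "awalk (snd e) p v"
      by (auto simp: awalk_Cons_iff)
    then have "(snd e, v) \<in> parcs G ^^ n"
      using Suc.IH \<open>length p = n\<close> arc_snd_in_verts by blast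
    then show "(u, v) \<in> parcs G ^^ Suc n"
      using e by (metis prod.collapse relpow_Suc_I2)
  qed
qed

lemma graph_dist_relpow:
  assumes "u \<in> pverts G"
  shows "graph_dist G u v = (INF n \<in> {n. (u, v) \<in> parcs G ^^ n}. ereal (real n))"
proof -
  have cost: "awalk_cost (\<lambda>_. 1) p = real (length p)" for p :: "('a \<times> 'a) list"
    by (induction p) auto
  have "{n. (u, v) \<in> parcs G ^^ n} = length ` {p. awalk u p v}"
    using relpow_iff_awalk[OF assms] by auto
  then show ?thesis
    by (simp add: graph_dist_def \<mu>_def cost image_image)
qed

text \<open>A nonempty set of lengths has a least element, at which the infimum is attained.\<close>

lemma graph_dist_eq_iff:
  assumes "u \<in> pverts G"
  shows "graph_dist G u v = ereal (real n) \<longleftrightarrow>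
    (u, v) \<in> parcs G ^^ n \<and> (\<forall>m<n. (u, v) \<notin> parcs G ^^ m)"
proof -
  define S where "S = {n. (u, v) \<in> parcs G ^^ n}"
  have eq: "graph_dist G u v = (INF n \<in> S. ereal (real n))"
    using graph_dist_relpow[OF assms] by (simp add: S_def)
  show ?thesis
  proof (cases "S = {}")
    case True
    \<comment> \<open>For an unreachable \<open>v\<close> the infimum over the empty set is
      infinite, so it equals no \<open>ereal (real n)\<close>.\<close>
    then show ?thesis
      using eq by (auto simp: S_def top_ereal_def)
  next
    case False
    define l where "l = (LEAST n. n \<in> S)"
    have l: "l \<in> S" "\<And>m. m \<in> S \<Longrightarrow> l \<le> m"
      using False LeastI Least_le unfolding l_def by (metis ex_in_conv)+
    have "graph_dist G u v = ereal (real l)"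
      unfolding eq using l by (intro INF_eqI) auto
    then show ?thesis
      using l by (auto simp: S_def not_less dest: leD)
        (metis antisym_conv2 linorder_not_le)
  qed
qed

lemma graph_dist_0_iff: "u \<in> pverts G \<Longrightarrow> graph_dist G u v = 0 \<longleftrightarrow> u = v"
  using graph_dist_eq_iff[of u v 0] by (auto simp: zero_ereal_def)

lemma graph_dist_1_iff:
  "u \<in> pverts G \<Longrightarrow> graph_dist G u v = 1 \<longleftrightarrow> u \<noteq> v \<and> (u, v) \<in> parcs G"
  using graph_dist_eq_iff[of u v 1] by (auto simp: one_ereal_def)

text \<open>The common neighbour \<open>w\<close> gives a walk of length 2, and the other
  assumptions exclude lengths 0 and 1. No larger exact distance has to be computed later.\<close>

lemma graph_dist_2I:
  assumes "u \<in> pverts G" "u \<noteq> v" "(u, v) \<notin> parcs G" "(u, w) \<in> parcs G" "(w, v) \<in> parcs G"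
  shows "graph_dist G u v = 2"
proof -
  have "(u, v) \<in> parcs G ^^ 2"
    using assms by (auto simp: numeral_2_eq_2)
  then have "graph_dist G u v = ereal (real 2)"
    using assms by (subst graph_dist_eq_iff) (auto simp: less_2_cases_iff)
  then show ?thesis by simp
qed

end


section \<open>Metric generators\<close>

text \<open>The set counted in \<open>k_metric_generator\<close> for the largest candidate,
  \<open>S = pverts X\<close>.\<close>

definition distinguishing :: "'a pair_pre_digraph \<Rightarrow> 'a \<Rightarrow> 'a \<Rightarrow> 'a set" where
  "distinguishing X x y = {w \<in> pverts X. graph_dist X x w \<noteq> graph_dist X y w}"

text \<open>Stated for arbitrary \<open>f\<close> because it serves every \<open>Min\<close> over
  distinct pairs: distinguishing sets, \<open>C_graph\<close>, and both twin branches of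
  \<open>T_vert\<close>.\<close>

lemma finite_distinct_pairs:
  assumes "finite A"
  shows "finite {f x y | x y. x \<in> A \<and> y \<in> A \<and> x \<noteq> y}"
proof (rule finite_subset)
  show "{f x y | x y. x \<in> A \<and> y \<in> A \<and> x \<noteq> y} \<subseteq> (\<lambda>(x, y). f x y) ` (A \<times> A)"
    by auto
qed (use assms in auto)

lemma two_verts_obtain:
  assumes "2 \<le> card A"
  obtains x y where "x \<in> A" "y \<in> A" "x \<noteq> y"
proof -
  obtain T where "T \<subseteq> A" "card T = 2"
    using assms obtain_subset_with_card_n by metis
  then show ?thesis
    using that by (auto simp: card_2_iff)
qed

context pair_fin_digraph
begin

text \<open>Enlarging \<open>S\<close> only enlarges the sets counted in the definition, so no
  generator beats the full vertex set.\<close>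

lemma k_metric_dimensional_iff:
  assumes "2 \<le> card (pverts G)"
  shows "k_metric_dimensional G k \<longleftrightarrow>
    k = Min {card (distinguishing G x y) | x y. x \<in> pverts G \<and> y \<in> pverts G \<and> x \<noteq> y}"
    (is "_ \<longleftrightarrow> k = Min ?D")
proof -
  obtain x y where xy: "x \<in> pverts G" "y \<in> pverts G" "x \<noteq> y"
    using assms by (rule two_verts_obtain)
  have fin: "finite ?D" and ne: "?D \<noteq> {}"
    using finite_distinct_pairs[OF pair_finite_verts] xy by auto
  \<comment> \<open>A generator requires \<open>0 < k\<close>. Each vertex is the only one at
    distance 0 from itself, so \<open>x\<close> distinguishes \<open>x\<close> from
    \<open>y\<close>.\<close>
  have pos: "0 < card (distinguishing G x y)"
    if "x \<in> pverts G" "y \<in> pverts G" "x \<noteq> y" for x y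
  proof -
    have "graph_dist G x x = 0" "graph_dist G y x \<noteq> 0"
      using that by (simp_all add: graph_dist_0_iff)
    then have "x \<in> distinguishing G x y"
      using that by (auto simp: distinguishing_def)
    then show ?thesis
      using pair_finite_verts by (auto simp: card_gt_0_iff distinguishing_def)
  qed
  have gen: "k_metric_generator G (Min ?D) (pverts G)"
    unfolding k_metric_generator_def
  proof (intro conjI ballI impI subset_refl)
    show "0 < Min ?D"
      using fin ne pos by (subst Min_gr_iff) auto
  next
    fix x y assume "x \<in> pverts G" "y \<in> pverts G" "x \<noteq> y"
    then show "Min ?D \<le> card {w \<in> pverts G. graph_dist G x w \<noteq> graph_dist G y w}"
      using fin by (intro Min_le) (auto simp: distinguishing_def)
  qed
  have le: "k' \<le> Min ?D" if g: "k_metric_generator G k' S" for k' S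
  proof -
    have "k' \<le> card (distinguishing G x y)"
      if "x \<in> pverts G" "y \<in> pverts G" "x \<noteq> y" for x y
    proof -
      have "k' \<le> card {w \<in> S. graph_dist G x w \<noteq> graph_dist G y w}"
        using g that by (auto simp: k_metric_generator_def)
      also have "\<dots> \<le> card (distinguishing G x y)"
        using g pair_finite_verts
        by (intro card_mono) (auto simp: distinguishing_def k_metric_generator_def)
      finally show ?thesis .
    qed
    then show ?thesis
      using fin ne by (subst Min_ge_iff) auto
  qed
  show ?thesis
  proof
    assume "k_metric_dimensional G k"
    then have "(\<exists>S. k_metric_generator G k S)" "Min ?D \<le> k"
      using gen unfolding k_metric_dimensional_def by blast+
    then show "k = Min ?D"
      using le by (meson order_antisym)
  next
    assume "k = Min ?D"
    then show "k_metric_dimensional G k"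
      using gen le unfolding k_metric_dimensional_def by blast
  qed
qed

end


section \<open>Twins\<close>

context pair_graph
begin

section \<open>Neighbourhoods and degrees in a simple graph\<close>

lemma sym_parcs: "(x, y) \<in> parcs G \<longleftrightarrow> (y, x) \<in> parcs G"
  using arcs_symmetric by blast

lemma irrefl_parcs: "(x, x) \<notin> parcs G"
  using no_loops' by blast

lemma nbhd_subset: "nbhd G x \<subseteq> pverts G"
  by (auto simp: in_nbhd_iff dest: in_arcsD2)

lemma finite_nbhd: "finite (nbhd G x)"
  using nbhd_subset pair_finite_verts finite_subset by blast

lemma out_degree_eq: "out_degree (with_proj G) x = card (nbhd G x)"
proof -
  have "out_arcs (with_proj G) x = Pair x ` nbhd G x"
    by (auto simp: out_arcs_def in_nbhd_iff)
  then show ?thesis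
    by (simp add: out_degree_def card_image inj_on_def)
qed

lemma min_degree_le: "x \<in> pverts G \<Longrightarrow> min_degree G \<le> card (nbhd G x)"
  unfolding min_degree_def using pair_finite_verts
  by (intro Min_le) (auto simp: out_degree_eq)

lemma max_degree_ge: "x \<in> pverts G \<Longrightarrow> card (nbhd G x) \<le> max_degree G"
  unfolding max_degree_def using pair_finite_verts
  by (intro Max_ge) (auto simp: out_degree_eq)

lemma min_degree_attained:
  assumes "pverts G \<noteq> {}"
  obtains x where "x \<in> pverts G" "card (nbhd G x) = min_degree G"
proof -
  have "min_degree G \<in> out_degree (with_proj G) ` pverts G"
    unfolding min_degree_def using assms pair_finite_verts by (intro Min_in) auto
  then show ?thesis using that by (auto simp: out_degree_eq)
qed

lemma max_degree_attained:
  assumes "pverts G \<noteq> {}"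
  obtains x where "x \<in> pverts G" "card (nbhd G x) = max_degree G"
proof -
  have "max_degree G \<in> out_degree (with_proj G) ` pverts G"
    unfolding max_degree_def using assms pair_finite_verts by (intro Max_in) auto
  then show ?thesis using that by (auto simp: out_degree_eq)
qed

lemma card_closed_nbhd: "card (closed_nbhd G x) = card (nbhd G x) + 1"
  using finite_nbhd by (simp add: closed_nbhd_def in_nbhd_iff irrefl_parcs)

lemma card_non_nbhd: "card (pverts G - nbhd G x) = card (pverts G) - card (nbhd G x)"
  using nbhd_subset finite_nbhd by (simp add: card_Diff_subset)

section \<open>The twin relation and its classes\<close>

lemma twin_relD:
  assumes "(x, y) \<in> twin_rel G" "z \<noteq> x" "z \<noteq> y"
  shows "(x, z) \<in> parcs G \<longleftrightarrow> (y, z) \<in> parcs G"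
  using assms unfolding twin_rel_def set_eq_iff by (auto simp: in_nbhd_iff)

lemma twin_relI:
  assumes "x \<in> pverts G" "y \<in> pverts G"
    and "\<And>z. z \<noteq> x \<Longrightarrow> z \<noteq> y \<Longrightarrow> (x, z) \<in> parcs G \<longleftrightarrow> (y, z) \<in> parcs G"
  shows "(x, y) \<in> twin_rel G"
proof -
  \<comment> \<open>At \<open>z = x\<close> and at \<open>z = y\<close> both sides are false by
    irreflexivity, so only third vertices matter.\<close>
  have "(x, z) \<in> parcs G \<and> z \<noteq> y \<longleftrightarrow> (y, z) \<in> parcs G \<and> z \<noteq> x" for z
    using assms(3)[of z] irrefl_parcs by (cases "z = x \<or> z = y") auto
  then show ?thesis
    using assms(1,2) by (simp add: twin_rel_def set_eq_iff in_nbhd_iff)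
qed

text \<open>If \<open>y\<close> differs from \<open>z\<close>, it is a third vertex for the twins
  \<open>x\<close>, \<open>z\<close>, so its adjacency to \<open>x\<close> passes to
  \<open>z\<close>. Then \<open>z\<close> is a third vertex for the twins \<open>x\<close>,
  \<open>y\<close>, so its adjacency to \<open>y\<close> passes to \<open>x\<close>.\<close>

lemma twin_rel_adjacent:
  assumes "(x, y) \<in> twin_rel G" "(x, z) \<in> twin_rel G" "(x, y) \<in> parcs G" "x \<noteq> z"
  shows "(x, z) \<in> parcs G"
  using twin_relD[OF assms(1)] twin_relD[OF assms(2)] assms(3,4) sym_parcs irrefl_parcs by metis

lemma twin_rel_sym: "(x, y) \<in> twin_rel G \<Longrightarrow> (y, x) \<in> twin_rel G"
  by (auto simp: twin_rel_def)

text \<open>A vertex other than \<open>x\<close>, \<open>y\<close>, \<open>z\<close> is handled by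
  the two given twin pairs. The critical vertex is \<open>y\<close> itself: by
  \<open>twin_rel_adjacent\<close> it is adjacent to both \<open>x\<close> and \<open>z\<close> or
  to neither.\<close>

lemma twin_rel_trans:
  assumes "(x, y) \<in> twin_rel G" "(y, z) \<in> twin_rel G"
  shows "(x, z) \<in> twin_rel G"
proof (cases "x = y \<or> y = z \<or> x = z")
  case True
  then show ?thesis using assms by (auto simp: twin_rel_def)
next
  case False
  show ?thesis
  proof (rule twin_relI)
    show "x \<in> pverts G" "z \<in> pverts G"
      using assms by (auto simp: twin_rel_def)
    fix w assume "w \<noteq> x" "w \<noteq> z"
    then show "(x, w) \<in> parcs G \<longleftrightarrow> (z, w) \<in> parcs G"
      using twin_relD[OF assms(1)] twin_relD[OF assms(2)] False
        twin_rel_adjacent[OF twin_rel_sym[OF assms(1)] assms(2)]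
        twin_rel_adjacent[OF assms(2) twin_rel_sym[OF assms(1)]] sym_parcs
      by metis
  qed
qed

lemma equiv_twin_rel: "equiv (pverts G) (twin_rel G)"
proof (rule equivI)
  show "twin_rel G \<subseteq> pverts G \<times> pverts G" "refl_on (pverts G) (twin_rel G)"
    by (auto simp: refl_on_def twin_rel_def)
  show "sym (twin_rel G)" using twin_rel_sym by (rule symI)
  show "trans (twin_rel G)" using twin_rel_trans by (rule transI)
qed

text \<open>Here and in \<open>true_twins_iff\<close>, adjacency of the pair is all that separates
  the two kinds of twins.\<close>

lemma false_twins_iff:
  assumes "x \<in> pverts G" "y \<in> pverts G"
  shows "false_twins G x y \<longleftrightarrow> x \<noteq> y \<and> (x, y) \<in> twin_rel G \<and> (x, y) \<notin> parcs G"
  using assms irrefl_parcs sym_parcs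
  unfolding false_twins_def twin_rel_def set_eq_iff by (auto simp: in_nbhd_iff)

lemma true_twins_iff:
  assumes "x \<in> pverts G" "y \<in> pverts G"
  shows "true_twins G x y \<longleftrightarrow> x \<noteq> y \<and> (x, y) \<in> twin_rel G \<and> (x, y) \<in> parcs G"
  using assms irrefl_parcs sym_parcs
  unfolding true_twins_def twin_rel_def closed_nbhd_def set_eq_iff
  by (auto simp: in_nbhd_iff)

text \<open>Classes are disjoint, so the only class containing \<open>u\<close> is its own. With
  \<open>P\<close> left open this covers all three of the vertex sets defined as unions of
  classes.\<close>

lemma in_class_union_iff:
  assumes "u \<in> pverts G"
  shows "u \<in> \<Union> {c \<in> pverts G // twin_rel G. P c} \<longleftrightarrow> P (twin_class G u)"
proof -
  have u: "u \<in> twin_class G u"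
    unfolding twin_class_def using equiv_class_self[OF equiv_twin_rel assms] .
  have cl: "twin_class G u \<in> pverts G // twin_rel G"
    unfolding twin_class_def using quotientI[OF assms] .
  have eq: "c = twin_class G u" if "c \<in> pverts G // twin_rel G" "u \<in> c" for c
    using quotient_disj[OF equiv_twin_rel that(1) cl] that(2) u by auto
  show ?thesis
  proof
    assume "u \<in> \<Union> {c \<in> pverts G // twin_rel G. P c}"
    then obtain c where "c \<in> pverts G // twin_rel G" "P c" "u \<in> c" by blast
    then show "P (twin_class G u)" using eq[of c] by simp
  next
    assume "P (twin_class G u)"
    then show "u \<in> \<Union> {c \<in> pverts G // twin_rel G. P c}" using u cl by blast
  qed
qed

lemma twin_class_pair:
  assumes "x \<in> twin_class G u" "y \<in> twin_class G u"
  shows "(x, y) \<in> twin_rel G"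
  using assms twin_rel_sym twin_rel_trans unfolding twin_class_def by blast

lemma twin_class_members:
  assumes "(u, u') \<in> twin_rel G"
  shows "u \<in> twin_class G u" "u' \<in> twin_class G u"
  using assms by (auto simp: twin_class_def twin_rel_def)

lemma singleton_verts_iff:
  assumes "u \<in> pverts G"
  shows "u \<in> singleton_verts G \<longleftrightarrow> (\<forall>x. (u, x) \<in> twin_rel G \<longrightarrow> x = u)"
proof -
  have "u \<in> twin_class G u" using assms by (simp add: twin_class_def twin_rel_def)
  then have "is_singleton (twin_class G u) \<longleftrightarrow> (\<forall>x \<in> twin_class G u. x = u)"
    by (metis is_singletonE is_singletonI' empty_iff singletonD)
  then show ?thesis
    unfolding singleton_verts_def in_class_union_iff[OF assms] by (auto simp: twin_class_def)
qed

text \<open>A class is a clique or an independent set. The edge is moved one endpoint at a time,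
  from \<open>x\<close>, \<open>y\<close> to \<open>x\<close>, \<open>z\<close> and then to
  \<open>z\<close>, \<open>w\<close>.\<close>

lemma twin_class_adjacent:
  assumes "x \<in> twin_class G u" "y \<in> twin_class G u" "x \<noteq> y"
    and "z \<in> twin_class G u" "w \<in> twin_class G u" "z \<noteq> w" "(x, y) \<in> parcs G"
  shows "(z, w) \<in> parcs G"
proof (cases "z = x")
  case True
  then show ?thesis
    using twin_rel_adjacent[OF twin_class_pair[OF assms(1,2)] twin_class_pair[OF assms(1,5)] assms(7)]
      assms(6) by simp
next
  case False
  then have "(z, x) \<in> parcs G"
    using twin_rel_adjacent[OF twin_class_pair[OF assms(1,2)] twin_class_pair[OF assms(1,4)] assms(7)]
      sym_parcs by auto
  then show ?thesis
    using twin_rel_adjacent[OF twin_class_pair[OF assms(4,1)] twin_class_pair[OF assms(4,5)]]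
      assms(6) by simp
qed

lemma twin_class_adjacent_iff:
  assumes "(u, v) \<in> twin_rel G" "u \<noteq> v"
    and "x \<in> twin_class G u" "y \<in> twin_class G u" "x \<noteq> y"
  shows "(x, y) \<in> parcs G \<longleftrightarrow> (u, v) \<in> parcs G"
  using twin_class_adjacent[OF assms(3-5) twin_class_members[OF assms(1)] assms(2)]
    twin_class_adjacent[OF twin_class_members[OF assms(1)] assms(2-5)]
  by blast

lemma twin_class_subset: "twin_class G u \<subseteq> pverts G"
  by (auto simp: twin_class_def twin_rel_def)

lemma finite_twin_class: "finite (twin_class G u)"
  using twin_class_subset pair_finite_verts finite_subset by blast

lemma not_singleton_twin_class:
  assumes "(u, v) \<in> twin_rel G" "u \<noteq> v"
  shows "\<not> is_singleton (twin_class G u)"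
  using twin_class_members[OF assms(1)] assms(2) by (auto simp: is_singleton_def)

text \<open>All pairs of a class agree on adjacency, so the quantified condition on the class
  reduces to the single pair \<open>u\<close>, \<open>v\<close>.\<close>

lemma false_twin_verts_iff:
  assumes "(u, v) \<in> twin_rel G" "u \<noteq> v"
  shows "u \<in> false_twin_verts G \<longleftrightarrow> (u, v) \<notin> parcs G"
proof -
  have u: "u \<in> pverts G"
    using assms by (auto simp: twin_rel_def)
  have "false_twins G x y \<longleftrightarrow> (u, v) \<notin> parcs G"
    if "x \<in> twin_class G u" "y \<in> twin_class G u" "x \<noteq> y" for x y
    using false_twins_iff[OF that(1,2)[THEN subsetD[OF twin_class_subset]]]
      twin_class_pair[OF that(1,2)] twin_class_adjacent_iff[OF assms that] that(3) by simp
  then have "(\<forall>x \<in> twin_class G u. \<forall>y \<in> twin_class G u. x \<noteq> y \<longrightarrow> false_twins G x y) \<longleftrightarrow>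
      (u, v) \<notin> parcs G"
    using twin_class_members[OF assms(1)] assms(2) by metis
  then show ?thesis
    unfolding false_twin_verts_def in_class_union_iff[OF u]
    using not_singleton_twin_class[OF assms] by simp
qed

lemma true_twin_verts_iff:
  assumes "(u, v) \<in> twin_rel G" "u \<noteq> v"
  shows "u \<in> true_twin_verts G \<longleftrightarrow> (u, v) \<in> parcs G"
proof -
  have u: "u \<in> pverts G"
    using assms by (auto simp: twin_rel_def)
  have "true_twins G x y \<longleftrightarrow> (u, v) \<in> parcs G"
    if "x \<in> twin_class G u" "y \<in> twin_class G u" "x \<noteq> y" for x y
    using true_twins_iff[OF that(1,2)[THEN subsetD[OF twin_class_subset]]]
      twin_class_pair[OF that(1,2)] twin_class_adjacent_iff[OF assms that] that(3) by simp
  then have "(\<forall>x \<in> twin_class G u. \<forall>y \<in> twin_class G u. x \<noteq> y \<longrightarrow> true_twins G x y) \<longleftrightarrow>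
      (u, v) \<in> parcs G"
    using twin_class_members[OF assms(1)] assms(2) by metis
  then show ?thesis
    unfolding true_twin_verts_def in_class_union_iff[OF u]
    using not_singleton_twin_class[OF assms] by simp
qed

section \<open>The quantity \<open>C_graph\<close> of one graph\<close>

lemma C_set_subset: "x \<in> pverts G \<Longrightarrow> y \<in> pverts G \<Longrightarrow> C_set G x y \<subseteq> pverts G"
  using nbhd_subset by (auto simp: C_set_def)

lemma C_graph_le:
  assumes "x \<in> pverts G" "y \<in> pverts G" "x \<noteq> y"
  shows "C_graph G \<le> card (C_set G x y)"
  unfolding C_graph_def using assms finite_distinct_pairs[OF pair_finite_verts]
  by (intro Min_le) auto

lemma C_graph_attained:
  assumes "2 \<le> card (pverts G)"
  obtains x y where "x \<in> pverts G" "y \<in> pverts G" "x \<noteq> y" "card (C_set G x y) = C_graph G"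
proof -
  let ?S = "{card (C_set G x y) | x y. x \<in> pverts G \<and> y \<in> pverts G \<and> x \<noteq> y}"
  obtain x y where "x \<in> pverts G" "y \<in> pverts G" "x \<noteq> y"
    using assms by (rule two_verts_obtain)
  then have "?S \<noteq> {}" by blast
  then have "C_graph G \<in> ?S"
    unfolding C_graph_def using finite_distinct_pairs[OF pair_finite_verts] by (intro Min_in) auto
  then show ?thesis using that by auto
qed

text \<open>This lets a whole fibre be compared with \<open>C_family\<close>, both for non-twins and
  for vertices in singleton classes.\<close>

lemma C_graph_le_card:
  assumes "2 \<le> card (pverts G)"
  shows "C_graph G \<le> card (pverts G)"
proof -
  obtain x y where "x \<in> pverts G" "y \<in> pverts G" "x \<noteq> y" "card (C_set G x y) = C_graph G"
    using assms by (rule C_graph_attained)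
  then show ?thesis
    using card_mono[OF pair_finite_verts C_set_subset] by metis
qed

end


section \<open>Lexicographic products\<close>

locale lexicographic_factors = pair_graph G for G :: "'a pair_pre_digraph" +
  fixes H :: "'a \<Rightarrow> 'b pair_pre_digraph"
  assumes connected: "Digraph_Component.connected (with_proj G)"
    and card_verts: "2 \<le> card (pverts G)"
    and pair_graph_fibre: "u \<in> pverts G \<Longrightarrow> pair_graph (H u)"
    and card_fibre: "u \<in> pverts G \<Longrightarrow> 2 \<le> card (pverts (H u))"
begin

abbreviation "X \<equiv> lexicographic_product G H"

section \<open>The product as a simple graph\<close>

lemma pverts_lex: "(u, v) \<in> pverts X \<longleftrightarrow> u \<in> pverts G \<and> v \<in> pverts (H u)"
  by (simp add: lexicographic_product_def)

lemma parcs_lex: "((u, v), (u', v')) \<in> parcs X \<longleftrightarrow>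
    (u, v) \<in> pverts X \<and> (u', v') \<in> pverts X \<and>
    ((u, u') \<in> parcs G \<or> u = u' \<and> (v, v') \<in> parcs (H u))"
  by (auto simp: lexicographic_product_def)

lemma finite_fibre:
  assumes "u \<in> pverts G"
  shows "finite (pverts (H u))"
proof -
  interpret fibre: pair_graph "H u" using assms by (rule pair_graph_fibre)
  show ?thesis by (rule fibre.pair_finite_verts)
qed

lemma fibre_nonempty:
  assumes "u \<in> pverts G"
  shows "pverts (H u) \<noteq> {}"
  using card_fibre[OF assms] by auto

lemma sym_fibre: "u \<in> pverts G \<Longrightarrow> (v, w) \<in> parcs (H u) \<longleftrightarrow> (w, v) \<in> parcs (H u)"
  by (rule pair_graph.sym_parcs[OF pair_graph_fibre])

lemma irrefl_fibre: "u \<in> pverts G \<Longrightarrow> (v, v) \<notin> parcs (H u)"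
  by (rule pair_graph.irrefl_parcs[OF pair_graph_fibre])

lemma pair_graph_lex: "pair_graph X"
proof -
  have arcs: "parcs X \<subseteq> pverts X \<times> pverts X"
    by (auto simp: parcs_lex)
  have "pverts X = (SIGMA u : pverts G. pverts (H u))"
    by (simp add: lexicographic_product_def)
  then have fin: "finite (pverts X)"
    using pair_finite_verts finite_fibre by auto
  have sym: "sym (parcs X)"
    using sym_parcs sym_fibre by (auto simp: sym_def parcs_lex pverts_lex)
  show ?thesis
  proof
    show "finite (pverts X)" by (rule fin)
    show "finite (parcs X)" using arcs fin finite_subset by blast
    show "symmetric (with_proj X)" using sym by (simp add: symmetric_def)
    show "fst e \<noteq> snd e" if "e \<in> parcs X" for e
      using that irrefl_parcs irrefl_fibre
      by (cases e) (auto simp: parcs_lex pverts_lex)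
  qed (use arcs in auto)
qed

sublocale lex: pair_graph X
  by (rule pair_graph_lex)

section \<open>Distances in the product\<close>

text \<open>Connectedness enters here: a walk from \<open>u\<close> to a second vertex has a first
  arc.\<close>

lemma neighbour_exists:
  assumes "u \<in> pverts G"
  obtains w where "(u, w) \<in> parcs G"
proof -
  have "pverts G \<noteq> {u}"
    using card_verts by auto
  then obtain v where v: "v \<in> pverts G" "v \<noteq> u"
    using assms by blast
  have "strongly_connected (with_proj G)"
    using symmetric_connected_imp_strongly_connected[OF pair_sym_arcs connected] .
  then have "u \<rightarrow>\<^sup>*\<^bsub>with_proj G\<^esub> v"
    using assms v by (auto simp: strongly_connected_def)
  then have "(u, v) \<in> (parcs G)\<^sup>*"
    using reachable_conv by blast
  then show ?thesis
    using v that by (auto elim: converse_rtranclE)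
qed

text \<open>An arc inside a fibre projects to standing still, so the projected walk may be
  shorter.\<close>

lemma walk_project:
  assumes "(x, y) \<in> parcs X ^^ n"
  shows "\<exists>m\<le>n. (fst x, fst y) \<in> parcs G ^^ m"
  using assms
proof (induction n arbitrary: y)
  case 0
  then show ?case by simp
next
  case (Suc n)
  then obtain z where z: "(x, z) \<in> parcs X ^^ n" "(z, y) \<in> parcs X"
    by auto
  then obtain m where m: "m \<le> n" "(fst x, fst z) \<in> parcs G ^^ m"
    using Suc.IH by blast
  have "(fst z, fst y) \<in> parcs G \<or> fst z = fst y"
    using z(2) parcs_lex by (metis prod.collapse)
  then show ?case
  proof
    assume "(fst z, fst y) \<in> parcs G"
    then show ?thesis
      using m by (intro exI[of _ "Suc m"]) auto
  next
    assume "fst z = fst y"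
    then show ?thesis
      using m by (intro exI[of _ m]) auto
  qed
qed

text \<open>An arc of \<open>G\<close> joins two whole fibres, so both end points over the walk can
  be prescribed. Length 0 is excluded because it cannot change the second coordinate.\<close>

lemma walk_lift:
  assumes "(u, u') \<in> parcs G ^^ n" "0 < n" "v \<in> pverts (H u)" "v' \<in> pverts (H u')"
  shows "((u, v), (u', v')) \<in> parcs X ^^ n"
  using assms
proof (induction n arbitrary: u v)
  case 0
  then show ?case by simp
next
  case (Suc n)
  then obtain w where w: "(u, w) \<in> parcs G" "(w, u') \<in> parcs G ^^ n"
    using relpow_Suc_D2 by metis
  show ?case
  proof (cases "n = 0")
    case True
    then show ?thesis
      using w Suc.prems in_arcsD1 in_arcsD2 by (auto simp: parcs_lex pverts_lex)
  next
    case False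
    obtain t where t: "t \<in> pverts (H w)"
      using fibre_nonempty in_arcsD2[OF w(1)] by blast
    have "((u, v), (w, t)) \<in> parcs X"
      using w t Suc.prems in_arcsD1 in_arcsD2 by (auto simp: parcs_lex pverts_lex)
    moreover have "((w, t), (u', v')) \<in> parcs X ^^ n"
      using Suc.IH w(2) False t Suc.prems by blast
    ultimately show ?thesis
      by (rule relpow_Suc_I2)
  qed
qed

lemma graph_dist_lex:
  assumes "(u, v) \<in> pverts X" "(u', v') \<in> pverts X" "u \<noteq> u'"
  shows "graph_dist X (u, v) (u', v') = graph_dist G u u'"
proof -
  have u: "u \<in> pverts G" using assms by (simp add: pverts_lex)
  show ?thesis
    unfolding graph_dist_relpow[OF u] lex.graph_dist_relpow[OF assms(1)]
  proof (rule antisym; rule INF_mono)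
    fix n assume "n \<in> {n. (u, u') \<in> parcs G ^^ n}"
    \<comment> \<open>Since \<open>u \<noteq> u'\<close>, the length is positive and
      \<open>walk_lift\<close> applies.\<close>
    then have "n \<in> {n. ((u, v), (u', v')) \<in> parcs X ^^ n}"
      using assms walk_lift[of u u' n v v'] by (cases "n = 0") (auto simp: pverts_lex)
    then show "\<exists>m\<in>{n. ((u, v), (u', v')) \<in> parcs X ^^ n}. ereal (real m) \<le> ereal (real n)"
      by blast
  next
    fix n assume "n \<in> {n. ((u, v), (u', v')) \<in> parcs X ^^ n}"
    then show "\<exists>m\<in>{n. (u, u') \<in> parcs G ^^ n}. ereal (real m) \<le> ereal (real n)"
      using walk_project by fastforce
  qed
qed

text \<open>Any vertex over a neighbour of \<open>u\<close> is adjacent to the whole fibre over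
  \<open>u\<close>, so distances there never exceed 2, even if \<open>H u\<close> is
  disconnected.\<close>

lemma graph_dist_same_fibre:
  assumes "(u, v) \<in> pverts X" "(u, w) \<in> pverts X"
  shows "graph_dist X (u, v) (u, w) = (if v = w then 0 else if (v, w) \<in> parcs (H u) then 1 else 2)"
proof -
  have u: "u \<in> pverts G" using assms by (simp add: pverts_lex)
  obtain a where a: "(u, a) \<in> parcs G" using u by (rule neighbour_exists)
  obtain t where t: "t \<in> pverts (H a)"
    using fibre_nonempty in_arcsD2[OF a] by blast
  have arcs: "((u, v), (a, t)) \<in> parcs X" "((a, t), (u, w)) \<in> parcs X"
    using a t assms in_arcsD2[OF a] sym_parcs by (auto simp: parcs_lex pverts_lex)
  consider "v = w" | "v \<noteq> w" "(v, w) \<in> parcs (H u)" | "v \<noteq> w" "(v, w) \<notin> parcs (H u)"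
    by blast
  then show ?thesis
  proof cases
    case 1
    then show ?thesis using lex.graph_dist_0_iff assms by simp
  next
    case 2
    then have "((u, v), (u, w)) \<in> parcs X" using assms by (simp add: parcs_lex)
    then show ?thesis using 2 lex.graph_dist_1_iff[OF assms(1)] by simp
  next
    case 3
    then have "((u, v), (u, w)) \<notin> parcs X" using irrefl_parcs by (simp add: parcs_lex)
    then show ?thesis using 3 lex.graph_dist_2I[OF assms(1) _ _ arcs] by simp
  qed
qed

section \<open>Distinguishing sets in the product\<close>

text \<open>Other fibres see only the first coordinate. Inside the fibre the distances 0, 1, 2
  record equality and adjacency, which leaves the two vertices and the symmetric difference of their
  neighbourhoods.\<close>

lemma distinguishing_same_fibre:
  assumes "(u, v) \<in> pverts X" "(u, v') \<in> pverts X" "v \<noteq> v'"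
  shows "distinguishing X (u, v) (u, v') = Pair u ` C_set (H u) v v'"
proof -
  have u: "u \<in> pverts G" using assms by (simp add: pverts_lex)
  have "(a, w) \<in> distinguishing X (u, v) (u, v') \<longleftrightarrow> (a, w) \<in> Pair u ` C_set (H u) v v'" for a w
  proof (cases "a = u \<and> w \<in> pverts (H u)")
    case True
    then have "(u, w) \<in> pverts X" using u by (simp add: pverts_lex)
    then show ?thesis
      using True assms irrefl_fibre[OF u]
      by (auto simp: distinguishing_def C_set_def in_nbhd_iff graph_dist_same_fibre)
  next
    case False
    have "C_set (H u) v v' \<subseteq> pverts (H u)"
      using assms pair_graph.C_set_subset[OF pair_graph_fibre[OF u]] by (simp add: pverts_lex)
    moreover have "(a, w) \<notin> distinguishing X (u, v) (u, v')"
      using False assms by (cases "a = u") (auto simp: distinguishing_def graph_dist_lex pverts_lex)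
    ultimately show ?thesis using False by blast
  qed
  then show ?thesis by auto
qed

text \<open>The first arc of a walk from \<open>u\<close> to \<open>a\<close> can be rerouted to
  start at the twin \<open>u'\<close>.\<close>

lemma graph_dist_twins_le:
  assumes "(u, u') \<in> twin_rel G" "a \<noteq> u" "a \<noteq> u'"
  shows "graph_dist G u' a \<le> graph_dist G u a"
proof -
  have V: "u \<in> pverts G" "u' \<in> pverts G" using assms by (auto simp: twin_rel_def)
  show ?thesis
    unfolding graph_dist_relpow[OF V(1)] graph_dist_relpow[OF V(2)]
  proof (rule INF_mono)
    fix n assume "n \<in> {n. (u, a) \<in> parcs G ^^ n}"
    then obtain m where m: "n = Suc m" "(u, a) \<in> parcs G ^^ Suc m"
      using assms by (cases n) auto
    then obtain w where w: "(u, w) \<in> parcs G" "(w, a) \<in> parcs G ^^ m"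
      using relpow_Suc_D2 by metis
    show "\<exists>m\<in>{n. (u', a) \<in> parcs G ^^ n}. ereal (real m) \<le> ereal (real n)"
    proof (cases "w = u'")
      \<comment> \<open>The walk already passes through \<open>u'\<close>; dropping its first arc
        leaves a shorter one.\<close>
      case True
      then show ?thesis using m w by (intro bexI[of _ m]) auto
    next
      case False
      have "w \<noteq> u" using w irrefl_parcs by blast
      then have "(u', w) \<in> parcs G" using twin_relD[OF assms(1)] False w by blast
      then have "(u', a) \<in> parcs G ^^ Suc m" using w by (blast intro: relpow_Suc_I2)
      then show ?thesis using m by blast
    qed
  qed
qed

lemma graph_dist_twins:
  assumes "(u, u') \<in> twin_rel G" "a \<noteq> u" "a \<noteq> u'"
  shows "graph_dist G u a = graph_dist G u' a"
  using assms graph_dist_twins_le twin_rel_sym by (intro antisym) blast+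

text \<open>Non-adjacent twins share all their neighbours, and \<open>neighbour_exists\<close>
  provides one.\<close>

lemma graph_dist_between_twins:
  assumes "(u, u') \<in> twin_rel G" "u \<noteq> u'"
  shows "graph_dist G u u' = (if (u, u') \<in> parcs G then 1 else 2)"
proof (cases "(u, u') \<in> parcs G")
  case True
  then show ?thesis using assms graph_dist_1_iff in_arcsD1 by simp
next
  case False
  have V: "u \<in> pverts G" using assms by (auto simp: twin_rel_def)
  obtain w where w: "(u, w) \<in> parcs G" using V by (rule neighbour_exists)
  then have "w \<noteq> u" "w \<noteq> u'" using False irrefl_parcs by blast+
  then have "(w, u') \<in> parcs G"
    using twin_relD[OF assms(1)] w sym_parcs by blast
  then show ?thesis using graph_dist_2I[OF V _ _ w] False assms by simp
qed

text \<open>Fibres over third vertices see no difference between twins. A vertex over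
  \<open>u\<close> has the distance of \<open>u\<close> and \<open>u'\<close> to
  \<open>(u', v')\<close>, so it distinguishes unless it has this same distance to
  \<open>(u, v)\<close>. Distance 1 removes the neighbours of \<open>v\<close>; distance 2 keeps
  exactly its closed neighbourhood.\<close>

lemma distinguishing_twins:
  assumes "(u, u') \<in> twin_rel G" "u \<noteq> u'" "v \<in> pverts (H u)" "v' \<in> pverts (H u')"
  defines "S \<equiv> \<lambda>a t. if (u, u') \<in> parcs G then pverts (H a) - nbhd (H a) t else closed_nbhd (H a) t"
  shows "distinguishing X (u, v) (u', v') = Pair u ` S u v \<union> Pair u' ` S u' v'"
proof -
  define e :: ereal where "e = (if (u, u') \<in> parcs G then 1 else 2)"
  have V: "u \<in> pverts G" "u' \<in> pverts G" using assms by (auto simp: twin_rel_def)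
  have X: "(u, v) \<in> pverts X" "(u', v') \<in> pverts X" using V assms by (auto simp: pverts_lex)
  have e: "graph_dist G u u' = e" "graph_dist G u' u = e"
    using graph_dist_between_twins[OF assms(1,2)]
      graph_dist_between_twins[OF twin_rel_sym[OF assms(1)]] assms(2) sym_parcs
    by (simp_all add: e_def)
  \<comment> \<open>Both forms of \<open>S\<close> are thus one condition: the distance within the
    fibre differs from \<open>e\<close>.\<close>
  have fib: "w \<in> S a t \<longleftrightarrow> w \<in> pverts (H a) \<and> graph_dist X (a, t) (a, w) \<noteq> e"
    if at: "(a, t) \<in> pverts X" for a t w
  proof (cases "w \<in> pverts (H a)")
    case True
    then have "(a, w) \<in> pverts X" using at by (simp add: pverts_lex)
    then show ?thesis
      using True at irrefl_fibre[of a t]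
      by (auto simp: graph_dist_same_fibre closed_nbhd_def in_nbhd_iff pverts_lex S_def e_def)
  next
    case False
    have "a \<in> pverts G" "t \<in> pverts (H a)" using at by (simp_all add: pverts_lex)
    then have "S a t \<subseteq> pverts (H a)"
      using pair_graph.nbhd_subset[OF pair_graph_fibre] by (simp add: S_def closed_nbhd_def)
    then show ?thesis using False by blast
  qed
  have "(a, w) \<in> distinguishing X (u, v) (u', v') \<longleftrightarrow>
    a = u \<and> w \<in> S u v \<or> a = u' \<and> w \<in> S u' v'" for a w
  proof -
    consider "(a, w) \<notin> pverts X" | "a = u" "(u, w) \<in> pverts X" | "a = u'" "(u', w) \<in> pverts X"
      | "a \<noteq> u" "a \<noteq> u'" "(a, w) \<in> pverts X" by blast
    then show ?thesis
    proof cases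
      case 1
      then show ?thesis
        using V fib[OF X(1), of w] fib[OF X(2), of w]
        by (auto simp: distinguishing_def pverts_lex)
    next
      case 2
      then have "graph_dist X (u', v') (a, w) = e"
        using graph_dist_lex[OF X(2) 2(2)] e assms(2) by simp
      then show ?thesis
        using 2 assms(2) fib[OF X(1), of w] by (simp add: distinguishing_def pverts_lex)
    next
      case 3
      then have d: "graph_dist X (u, v) (a, w) = e"
        using graph_dist_lex[OF X(1) 3(2)] e assms(2) by simp
      have "(a, w) \<in> distinguishing X (u, v) (u', v') \<longleftrightarrow> graph_dist X (u', v') (u', w) \<noteq> e"
        using 3 d by (simp add: distinguishing_def eq_commute[of e])
      then show ?thesis
        using 3 assms(2) fib[OF X(2), of w] by (simp add: pverts_lex)
    next
      case 4
      then have "graph_dist X (u, v) (a, w) = graph_dist X (u', v') (a, w)"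
        using graph_dist_lex[OF X(1) 4(3)] graph_dist_lex[OF X(2) 4(3)]
          graph_dist_twins[OF assms(1)] by simp
      then show ?thesis using 4 by (simp add: distinguishing_def)
    qed
  qed
  then show ?thesis by auto
qed

text \<open>The two closed neighbourhoods lie in different fibres; their centres account for the
  summand 2.\<close>

lemma card_distinguishing_false_twins:
  assumes "(u, u') \<in> twin_rel G" "u \<noteq> u'" "(u, u') \<notin> parcs G"
    and "v \<in> pverts (H u)" "v' \<in> pverts (H u')"
  shows "card (distinguishing X (u, v) (u', v')) = card (nbhd (H u) v) + card (nbhd (H u') v') + 2"
proof -
  have V: "u \<in> pverts G" "u' \<in> pverts G" using assms by (auto simp: twin_rel_def)
  interpret Hu: pair_graph "H u" using V by (intro pair_graph_fibre)
  interpret Hu': pair_graph "H u'" using V by (intro pair_graph_fibre)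
  have "finite (closed_nbhd (H u) v)" "finite (closed_nbhd (H u') v')"
    using Hu.finite_nbhd Hu'.finite_nbhd by (auto simp: closed_nbhd_def)
  then have "card (Pair u ` closed_nbhd (H u) v \<union> Pair u' ` closed_nbhd (H u') v') =
    card (closed_nbhd (H u) v) + card (closed_nbhd (H u') v')"
    using assms(2) by (subst card_Un_disjoint) (auto simp: card_image inj_on_def)
  then show ?thesis
    using assms by (simp add: distinguishing_twins Hu.card_closed_nbhd Hu'.card_closed_nbhd)
qed

lemma card_distinguishing_true_twins:
  assumes "(u, u') \<in> twin_rel G" "u \<noteq> u'" "(u, u') \<in> parcs G"
    and "v \<in> pverts (H u)" "v' \<in> pverts (H u')"
  shows "card (distinguishing X (u, v) (u', v')) =
    (card (pverts (H u)) - card (nbhd (H u) v)) + (card (pverts (H u')) - card (nbhd (H u') v'))"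
proof -
  have V: "u \<in> pverts G" "u' \<in> pverts G" using assms by (auto simp: twin_rel_def)
  interpret Hu: pair_graph "H u" using V by (intro pair_graph_fibre)
  interpret Hu': pair_graph "H u'" using V by (intro pair_graph_fibre)
  have "card (Pair u ` (pverts (H u) - nbhd (H u) v) \<union> Pair u' ` (pverts (H u') - nbhd (H u') v')) =
    card (pverts (H u) - nbhd (H u) v) + card (pverts (H u') - nbhd (H u') v')"
    using assms(2) finite_fibre V by (subst card_Un_disjoint) (auto simp: card_image inj_on_def)
  then show ?thesis
    using assms by (simp add: distinguishing_twins Hu.card_non_nbhd Hu'.card_non_nbhd)
qed

text \<open>Some third vertex \<open>a\<close> is adjacent to exactly one of \<open>u\<close>,
  \<open>u'\<close>. It is at distance 1 from that one only, so every vertex over \<open>a\<close>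
  distinguishes the pair.\<close>

lemma card_distinguishing_non_twins:
  assumes "(u, u') \<notin> twin_rel G" "(u, v) \<in> pverts X" "(u', v') \<in> pverts X"
  obtains a where "a \<in> pverts G" "card (pverts (H a)) \<le> card (distinguishing X (u, v) (u', v'))"
proof -
  have V: "u \<in> pverts G" "u' \<in> pverts G" using assms by (auto simp: pverts_lex)
  obtain a where a: "a \<noteq> u" "a \<noteq> u'" "(u, a) \<in> parcs G \<longleftrightarrow> (u', a) \<notin> parcs G"
    using contrapos_nn[OF assms(1) twin_relI[OF V]] by auto
  then have aV: "a \<in> pverts G" using in_arcsD2 by blast
  have "graph_dist G u a = 1 \<longleftrightarrow> graph_dist G u' a \<noteq> 1"
    using a graph_dist_1_iff[OF V(1)] graph_dist_1_iff[OF V(2)] by auto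
  then have "graph_dist G u a \<noteq> graph_dist G u' a"
    by auto
  then have "Pair a ` pverts (H a) \<subseteq> distinguishing X (u, v) (u', v')"
    using a aV assms by (auto simp: distinguishing_def pverts_lex graph_dist_lex)
  moreover have "finite (distinguishing X (u, v) (u', v'))"
    using lex.pair_finite_verts by (simp add: distinguishing_def)
  ultimately have "card (Pair a ` pverts (H a)) \<le> card (distinguishing X (u, v) (u', v'))"
    by (intro card_mono)
  then show ?thesis
    using that[OF aV] by (simp add: card_image inj_on_def)
qed

section \<open>Comparison with \<open>T_family\<close> and \<open>C_family\<close>\<close>

lemma C_family_le: "u \<in> pverts G \<Longrightarrow> C_family G H \<le> C_graph (H u)"
  unfolding C_family_def using pair_finite_verts by (intro Min_le) auto

lemma C_family_le_card: "u \<in> pverts G \<Longrightarrow> C_family G H \<le> card (pverts (H u))"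
  using C_family_le pair_graph.C_graph_le_card pair_graph_fibre card_fibre order_trans by metis

lemma T_family_le: "u \<in> pverts G \<Longrightarrow> T_family G H \<le> T_vert G H u"
  unfolding T_family_def using pair_finite_verts by (intro Min_le) auto

text \<open>One twin \<open>u'\<close> settles the kind of the whole class and thereby the branch of
  \<open>T_vert\<close>.\<close>

lemma T_vert_false_twins:
  assumes "(u, u') \<in> twin_rel G" "u \<noteq> u'" "(u, u') \<notin> parcs G"
  shows "T_vert G H u = Min {min_degree (H j) + min_degree (H l) + 2 | j l.
    j \<in> twin_class G u \<and> l \<in> twin_class G u \<and> j \<noteq> l}"
proof -
  have "u \<in> pverts G" using assms by (auto simp: twin_rel_def)
  then have "u \<notin> singleton_verts G" "u \<in> false_twin_verts G"
    using assms singleton_verts_iff false_twin_verts_iff by auto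
  then show ?thesis by (simp add: T_vert_def)
qed

lemma T_vert_true_twins:
  assumes "(u, u') \<in> twin_rel G" "u \<noteq> u'" "(u, u') \<in> parcs G"
  shows "T_vert G H u = Min {(card (pverts (H j)) - max_degree (H j)) +
    (card (pverts (H l)) - max_degree (H l)) | j l.
    j \<in> twin_class G u \<and> l \<in> twin_class G u \<and> j \<noteq> l}"
proof -
  have "u \<in> pverts G" using assms by (auto simp: twin_rel_def)
  then have "u \<notin> singleton_verts G" "u \<notin> false_twin_verts G" "u \<in> true_twin_verts G"
    using assms singleton_verts_iff false_twin_verts_iff true_twin_verts_iff by auto
  then show ?thesis by (simp add: T_vert_def)
qed

text \<open>Pairs over one fibre or over non-twins are bounded through \<open>C_family\<close>,
  pairs over distinct twins through \<open>T_family\<close>.\<close>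

lemma card_distinguishing_ge:
  assumes "x \<in> pverts X" "y \<in> pverts X" "x \<noteq> y"
  shows "min (T_family G H) (C_family G H) \<le> card (distinguishing X x y)"
proof -
  obtain u v u' v' where xy: "x = (u, v)" "y = (u', v')"
    by (metis prod.collapse)
  have V: "u \<in> pverts G" "u' \<in> pverts G" "v \<in> pverts (H u)" "v' \<in> pverts (H u')"
    using assms xy by (auto simp: pverts_lex)
  interpret Hu: pair_graph "H u" using V by (intro pair_graph_fibre)
  interpret Hu': pair_graph "H u'" using V by (intro pair_graph_fibre)
  consider (fibre) "u = u'" | (non_twins) "(u, u') \<notin> twin_rel G"
    | (false_twins) "u \<noteq> u'" "(u, u') \<in> twin_rel G" "(u, u') \<notin> parcs G"
    | (true_twins) "u \<noteq> u'" "(u, u') \<in> twin_rel G" "(u, u') \<in> parcs G"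
    by blast
  then show ?thesis
  proof cases
    case fibre
    then have "v \<noteq> v'" using assms xy by simp
    have "C_family G H \<le> C_graph (H u)"
      using V by (intro C_family_le)
    also have "\<dots> \<le> card (C_set (H u) v v')"
      using V fibre \<open>v \<noteq> v'\<close> by (intro Hu.C_graph_le) auto
    also have "\<dots> = card (distinguishing X x y)"
      using assms xy fibre \<open>v \<noteq> v'\<close>
      by (simp add: distinguishing_same_fibre card_image inj_on_def)
    finally show ?thesis by simp
  next
    case non_twins
    then obtain a where "a \<in> pverts G" "card (pverts (H a)) \<le> card (distinguishing X x y)"
      using assms xy card_distinguishing_non_twins by metis
    then show ?thesis
      using C_family_le_card by (meson min.coboundedI2 order_trans)
  next
    case false_twins
    have "T_family G H \<le> T_vert G H u"
      using V by (intro T_family_le)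
    also have "\<dots> \<le> min_degree (H u) + min_degree (H u') + 2"
      unfolding T_vert_false_twins[OF false_twins(2,1,3)]
      using finite_distinct_pairs[OF finite_twin_class] twin_class_members[OF false_twins(2)]
        false_twins(1) by (intro Min_le) auto
    also have "\<dots> \<le> card (distinguishing X x y)"
      using card_distinguishing_false_twins[OF false_twins(2,1,3) V(3,4)]
        Hu.min_degree_le[OF V(3)] Hu'.min_degree_le[OF V(4)] xy by simp
    finally show ?thesis by simp
  next
    case true_twins
    have "T_family G H \<le> T_vert G H u"
      using V by (intro T_family_le)
    also have "\<dots> \<le> (card (pverts (H u)) - max_degree (H u)) +
        (card (pverts (H u')) - max_degree (H u'))"
      unfolding T_vert_true_twins[OF true_twins(2,1,3)]
      using finite_distinct_pairs[OF finite_twin_class] twin_class_members[OF true_twins(2)]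
        true_twins(1) by (intro Min_le) auto
    \<comment> \<open>Subtracting the maximum degree gives the smallest possible non-neighbourhood
      in each fibre.\<close>
    also have "\<dots> \<le> card (distinguishing X x y)"
      using card_distinguishing_true_twins[OF true_twins(2,1,3) V(3,4)]
        Hu.max_degree_ge[OF V(3)] Hu'.max_degree_ge[OF V(4)] xy by simp
    finally show ?thesis by simp
  qed
qed

text \<open>The witnesses lie in one fibre and attain the minimum in its
  \<open>C_graph\<close>.\<close>

lemma C_family_attained:
  "\<exists>x\<in>pverts X. \<exists>y\<in>pverts X. x \<noteq> y \<and> card (distinguishing X x y) = C_family G H"
proof -
  have "C_family G H \<in> (\<lambda>u. C_graph (H u)) ` pverts G"
    unfolding C_family_def using pair_finite_verts card_verts by (intro Min_in) auto
  then obtain u where u: "u \<in> pverts G" "C_family G H = C_graph (H u)"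
    by blast
  obtain v v' where v: "v \<in> pverts (H u)" "v' \<in> pverts (H u)" "v \<noteq> v'"
    "card (C_set (H u) v v') = C_graph (H u)"
    using pair_graph.C_graph_attained[OF pair_graph_fibre card_fibre] u(1) by metis
  then have "card (distinguishing X (u, v) (u, v')) = C_family G H"
    using u by (simp add: distinguishing_same_fibre pverts_lex card_image inj_on_def)
  then show ?thesis
    using u v by (intro bexI[of _ "(u, v)"] bexI[of _ "(u, v')"]) (auto simp: pverts_lex)
qed

text \<open>
  The vertices without twins do not contribute to the minimum of \<open>\<T>\<close> and \<open>\<C>\<close>, since a fibre
  has at least \<open>\<C>\<close> vertices.
\<close>

lemma T_family_attained:
  assumes "T_family G H < C_family G H"
  shows "\<exists>x\<in>pverts X. \<exists>y\<in>pverts X. x \<noteq> y \<and> card (distinguishing X x y) = T_family G H"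
proof -
  have "T_family G H \<in> T_vert G H ` pverts G"
    unfolding T_family_def using pair_finite_verts card_verts by (intro Min_in) auto
  then obtain u where u: "u \<in> pverts G" "T_family G H = T_vert G H u"
    by blast
  have "u \<notin> singleton_verts G"
    using u assms C_family_le_card[OF u(1)] by (auto simp: T_vert_def)
  then obtain u' where u': "(u, u') \<in> twin_rel G" "u \<noteq> u'"
    using singleton_verts_iff[OF u(1)] by blast
  note cl = twin_class_members[OF u'(1)]
  show ?thesis
  proof (cases "(u, u') \<in> parcs G")
    case False
    let ?S = "{min_degree (H j) + min_degree (H l) + 2 | j l.
      j \<in> twin_class G u \<and> l \<in> twin_class G u \<and> j \<noteq> l}"
    have "?S \<noteq> {}" using cl u' by blast
    then have "T_vert G H u \<in> ?S"
      unfolding T_vert_false_twins[OF u' False]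
      using finite_distinct_pairs[OF finite_twin_class] by (intro Min_in) auto
    then obtain j l where jl: "j \<in> twin_class G u" "l \<in> twin_class G u" "j \<noteq> l"
      "T_vert G H u = min_degree (H j) + min_degree (H l) + 2" by blast
    have V: "j \<in> pverts G" "l \<in> pverts G" using jl twin_class_subset by blast+
    obtain v where v: "v \<in> pverts (H j)" "card (nbhd (H j) v) = min_degree (H j)"
      using pair_graph.min_degree_attained[OF pair_graph_fibre fibre_nonempty] V by metis
    obtain w where w: "w \<in> pverts (H l)" "card (nbhd (H l) w) = min_degree (H l)"
      using pair_graph.min_degree_attained[OF pair_graph_fibre fibre_nonempty] V by metis
    \<comment> \<open>The minimising pair \<open>j\<close>, \<open>l\<close> need not be
      \<open>u\<close>, \<open>u'\<close>, but every pair of the class has the same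
      adjacency.\<close>
    have "(j, l) \<notin> parcs G"
      using False twin_class_adjacent_iff[OF u' jl(1-3)] by blast
    then have "card (distinguishing X (j, v) (l, w)) = T_family G H"
      using card_distinguishing_false_twins[OF twin_class_pair[OF jl(1,2)] jl(3)] v w u jl by simp
    then show ?thesis
      using V v w jl by (intro bexI[of _ "(j, v)"] bexI[of _ "(l, w)"]) (auto simp: pverts_lex)
  next
    case True
    let ?S = "{(card (pverts (H j)) - max_degree (H j)) + (card (pverts (H l)) - max_degree (H l)) | j l.
      j \<in> twin_class G u \<and> l \<in> twin_class G u \<and> j \<noteq> l}"
    have "?S \<noteq> {}" using cl u' by blast
    then have "T_vert G H u \<in> ?S"
      unfolding T_vert_true_twins[OF u' True]
      using finite_distinct_pairs[OF finite_twin_class] by (intro Min_in) auto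
    then obtain j l where jl: "j \<in> twin_class G u" "l \<in> twin_class G u" "j \<noteq> l"
      "T_vert G H u = (card (pverts (H j)) - max_degree (H j)) +
        (card (pverts (H l)) - max_degree (H l))" by blast
    have V: "j \<in> pverts G" "l \<in> pverts G" using jl twin_class_subset by blast+
    \<comment> \<open>For adjacent twins the complements of neighbourhoods count, so vertices of
      maximum degree are the extremal ones.\<close>
    obtain v where v: "v \<in> pverts (H j)" "card (nbhd (H j) v) = max_degree (H j)"
      using pair_graph.max_degree_attained[OF pair_graph_fibre fibre_nonempty] V by metis
    obtain w where w: "w \<in> pverts (H l)" "card (nbhd (H l) w) = max_degree (H l)"
      using pair_graph.max_degree_attained[OF pair_graph_fibre fibre_nonempty] V by metis
    have "(j, l) \<in> parcs G"
      using True twin_class_adjacent_iff[OF u' jl(1-3)] by blast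
    then have "card (distinguishing X (j, v) (l, w)) = T_family G H"
      using card_distinguishing_true_twins[OF twin_class_pair[OF jl(1,2)] jl(3)] v w u jl by simp
    then show ?thesis
      using V v w jl by (intro bexI[of _ "(j, v)"] bexI[of _ "(l, w)"]) (auto simp: pverts_lex)
  qed
qed

lemma card_pverts_lex: "2 \<le> card (pverts X)"
proof -
  obtain u where u: "u \<in> pverts G"
    using card_verts by force
  have "card (Pair u ` pverts (H u)) \<le> card (pverts X)"
    using u lex.pair_finite_verts by (intro card_mono) (auto simp: pverts_lex)
  then show ?thesis
    using card_fibre[OF u] by (simp add: card_image inj_on_def)
qed

lemma k_metric_dimensional_lex_iff:
  "k_metric_dimensional X k \<longleftrightarrow> k = min (T_family G H) (C_family G H)"
proof -
  let ?D = "{card (distinguishing X x y) | x y. x \<in> pverts X \<and> y \<in> pverts X \<and> x \<noteq> y}"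
  \<comment> \<open>Together with the lower bound \<open>card_distinguishing_ge\<close>, membership
    identifies the minimum of \<open>?D\<close>. The smaller quantity provides the pair, with ties
    going to \<open>C_family\<close>.\<close>
  have "min (T_family G H) (C_family G H) \<in> ?D"
  proof (cases "T_family G H < C_family G H")
    case True
    then show ?thesis using T_family_attained by (fastforce simp: min_def)
  next
    case False
    then show ?thesis using C_family_attained by (fastforce simp: min_def)
  qed
  then have "Min ?D = min (T_family G H) (C_family G H)"
    using finite_distinct_pairs[OF lex.pair_finite_verts] card_distinguishing_ge
    by (intro Min_eqI) auto
  then show ?thesis
    using lex.k_metric_dimensional_iff[OF card_pverts_lex] by simp
qed

end

theorem theorem5:
  fixes G :: "'a pair_pre_digraph"
    and H :: "'a \<Rightarrow> 'b pair_pre_digraph"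
    and k :: nat
  assumes "pair_graph G"
    and "Digraph_Component.connected (with_proj G)"
    and "card (pverts G) \<ge> 2"
    and "\<And>u. u \<in> pverts G \<Longrightarrow> pair_graph (H u)"
    and "\<And>u. u \<in> pverts G \<Longrightarrow> card (pverts (H u)) \<ge> 2"
  shows "k_metric_dimensional (lexicographic_product G H) k \<longleftrightarrow> k = min (T_family G H) (C_family G H)"
proof -
  interpret lexicographic_factors G H
    using assms by (intro lexicographic_factors.intro lexicographic_factors_axioms.intro)
  show ?thesis by (rule k_metric_dimensional_lex_iff)
qed

end
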